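(* Let $p$ be a positive integer and suppose that $X$ is a random variable on $[0,b]$. Let $z(s)$ be the right-hand side of the moment-generating function bound $\mathbb{E}\exp(sX)\leq z(s)$ ($s\geq 0$), that is, $$z(s):=\frac{\mathbb{E}(X^{p})}{b^{p}}\,T_{p+1}(sb)+\mathbb{E}\left(\sum_{j=0}^{p-1}\frac{s^{j}X^{j}}{j!}\right).$$ Then the derivative of $z(s)$ is log-convex on $(0,\infty)$, i.e., $\log(z^{(1)}(s))$ is a convex function on $(0,\infty)$.
   Context: A random variable $X$ is said to be a random variable on $[a,b]$, for some $a<b$, if $\mathbb{P}(X\in[a,b])=1$; so here $b>0$ and $\mathbb{P}(X\in[0,b])=1$. For every positive integer $k$, $T_{k}(x):=\exp(x)-\sum_{j=0}^{k-2}\frac{x^{j}}{j!}$, with the convention that $\sum_{j=0}^{m}a_{j}=0$ whenever $m<0$, so $T_{1}(x)=\exp(x)$. $z^{(1)}$ denotes the first derivative of $z$ with respect to $s$. The $j=0$ term of the sum in $z$ is $1$. *)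

theory Defs
  imports "HOL-Probability.Probability"
begin

text \<open>
  \<open>T k x\<close> is meant for \<open>k \<ge> 1\<close>. The index range \<open>j < k - 1\<close> is \<open>0 \<le> j \<le> k - 2\<close>; writing it
  as \<open>j \<le> k - 2\<close> would be wrong at \<open>k = 1\<close>, where subtraction on the naturals truncates.
\<close>
definition T :: "nat \<Rightarrow> real \<Rightarrow> real" where
  "T k x = exp x - (\<Sum>j<k - 1. x ^ j / fact j)"

text \<open>
  The upper bound on the moment-generating function of \<open>X\<close> at \<open>s \<ge> 0\<close>, as a function of \<open>s\<close>.
  Since \<open>0 ^ 0 = 1\<close>, the \<open>j = 0\<close> term of the sum is \<open>1\<close>.
\<close>
definition mgf_bound :: "'a measure \<Rightarrow> ('a \<Rightarrow> real) \<Rightarrow> real \<Rightarrow> nat \<Rightarrow> real \<Rightarrow> real" where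
  "mgf_bound M X b p s =
     (\<integral>\<omega>. X \<omega> ^ p \<partial>M) / b ^ p * T (p + 1) (s * b)
     + (\<integral>\<omega>. (\<Sum>j<p. s ^ j * X \<omega> ^ j / fact j) \<partial>M)"

end

theory Submission imports Defs begin

text \<open>
  Write \<open>m n\<close> for the \<open>n\<close>-th moment of \<open>X\<close>. Expanding the exponential in \<open>z\<close> gives the
  exponential generating function \<open>z s = (\<Sum>n. c n * s ^ n / n!)\<close> with \<open>c n = m n\<close> for
  \<open>n \<le> p\<close> and \<open>c n = m p * b ^ (n - p)\<close> for \<open>n \<ge> p\<close>: the moments, continued geometrically
  with ratio \<open>b\<close>. Differentiating such a series shifts its coefficients.

  The sequence \<open>c\<close> is log-convex, \<open>c (n + 1)\<^sup>2 \<le> c n * c (n + 2)\<close>: below \<open>p\<close> this is the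
  Cauchy--Schwarz inequality for moments, above \<open>p\<close> it is an equality, and at the junction it
  is \<open>m p \<le> b * m (p - 1)\<close>, which holds because \<open>X \<le> b\<close>
  (\<open>log_convex_extended_moments\<close>). Log-convexity of the coefficients passes to the generating
  function (\<open>log_convex_egf\<close>): it says that the quadratics
  \<open>c n + 2 t c (n + 1) + t\<^sup>2 c (n + 2)\<close> are nonnegative in \<open>t\<close>, so their combination
  \<open>g + 2 t g' + t\<^sup>2 g''\<close> with the weights \<open>s ^ n / n!\<close> is nonnegative too, whence
  \<open>g'\<^sup>2 \<le> g g''\<close>, that is, \<open>(ln g)'' \<ge> 0\<close>. This is applied to the shifted sequence, whose
  generating function is \<open>z'\<close>. If \<open>X = 0\<close> almost surely, \<open>z'\<close> vanishes identically; by the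
  convention \<open>ln 0 = 0\<close> the logarithm is then constant.
\<close>

section \<open>Exponential generating functions of log-convex sequences\<close>

text \<open>
  The right-hand side is linear in \<open>(A, B, C)\<close> and so survives sums and integrals; this is how
  both Cauchy--Schwarz arguments below are carried out.
\<close>
lemma discriminant_le_iff_quadratic_nonneg:
  fixes A B C :: real
  assumes "A \<ge> 0" "C \<ge> 0"
  shows "B\<^sup>2 \<le> A * C \<longleftrightarrow> (\<forall>t. 0 \<le> A + 2 * t * B + t\<^sup>2 * C)"
proof
  assume le: "B\<^sup>2 \<le> A * C"
  show "\<forall>t. 0 \<le> A + 2 * t * B + t\<^sup>2 * C"
  proof
    fix t
    show "0 \<le> A + 2 * t * B + t\<^sup>2 * C"
    proof (cases "C = 0")
      case True
      then show ?thesis using le assms by simp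
    next
      case False
      then have C: "C > 0" using assms by simp
      have "C * (A + 2 * t * B + t\<^sup>2 * C) = (A * C - B\<^sup>2) + (B + t * C)\<^sup>2"
        by (simp add: power2_eq_square algebra_simps)
      also have "\<dots> \<ge> 0" using le by simp
      finally show ?thesis using C by (simp add: zero_le_mult_iff)
    qed
  qed
next
  assume q: "\<forall>t. 0 \<le> A + 2 * t * B + t\<^sup>2 * C"
  show "B\<^sup>2 \<le> A * C"
  proof (cases "C = 0")
    case True
    have "B = 0"
    proof (rule ccontr)
      assume B: "B \<noteq> 0"
      have "0 \<le> A + 2 * (- (A + 1) / (2 * B)) * B" using q True by (metis add.right_neutral mult_zero_right)
      also have "\<dots> = -1" using B by (simp add: field_simps)
      finally show False by simp
    qed
    then show ?thesis using True by simp
  next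
    case False
    then have C: "C > 0" using assms by simp
    have "0 \<le> A + 2 * (- B / C) * B + (- B / C)\<^sup>2 * C" using q by blast
    also have "\<dots> = (A * C - B\<^sup>2) / C" using C by (simp add: field_simps power2_eq_square)
    finally show ?thesis using C by (simp add: zero_le_divide_iff)
  qed
qed

definition egf :: "(nat \<Rightarrow> real) \<Rightarrow> real \<Rightarrow> real" where
  "egf a s = (\<Sum>n. a n / fact n * s ^ n)"

lemma le_geometric_of_ratio_le:
  fixes a :: "nat \<Rightarrow> real"
  assumes "b \<ge> 0" "\<And>n. a (Suc n) \<le> b * a n"
  shows "a n \<le> a 0 * b ^ n"
proof (induction n)
  case (Suc n)
  have "a (Suc n) \<le> b * a n" by (rule assms)
  also have "\<dots> \<le> b * (a 0 * b ^ n)" using Suc assms(1) by (rule mult_left_mono)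
  finally show ?case by (simp add: ac_simps)
qed simp

lemma summable_egf:
  fixes a :: "nat \<Rightarrow> real"
  assumes "b \<ge> 0" "\<And>n. 0 \<le> a n" "\<And>n. a (Suc n) \<le> b * a n"
  shows "summable (\<lambda>n. a n / fact n * s ^ n)"
proof (rule summable_comparison_test')
  show "summable (\<lambda>n. a 0 * (inverse (fact n) * (b * \<bar>s\<bar>) ^ n))"
    by (intro summable_mult summable_exp)
  fix n
  have "norm (a n / fact n * s ^ n) = a n * (\<bar>s\<bar> ^ n / fact n)"
    using assms(2) by (simp add: abs_mult power_abs)
  also have "\<dots> \<le> (a 0 * b ^ n) * (\<bar>s\<bar> ^ n / fact n)"
    by (intro mult_right_mono le_geometric_of_ratio_le assms) simp
  finally show "norm (a n / fact n * s ^ n) \<le> a 0 * (inverse (fact n) * (b * \<bar>s\<bar>) ^ n)"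
    by (simp add: power_mult_distrib field_simps)
qed

lemma has_real_derivative_egf:
  assumes "\<And>s. summable (\<lambda>n. a n / fact n * s ^ n)"
  shows "(egf a has_real_derivative egf (\<lambda>n. a (Suc n)) s) (at s)"
proof -
  have "diffs (\<lambda>n. a n / fact n) = (\<lambda>n. a (Suc n) / fact n)"
    by (rule ext) (simp add: diffs_def field_simps del: of_nat_Suc)
  with termdiffs_strong_converges_everywhere[OF assms, of s] show ?thesis
    by (simp add: egf_def[abs_def])
qed

text \<open>
  The constant term alone bounds the series from below, since no term is negative.
\<close>
lemma egf_ge_constant_term:
  assumes "summable (\<lambda>n. a n / fact n * s ^ n)" "\<And>n. 0 \<le> a n" "s \<ge> 0"
  shows "a 0 \<le> egf a s"
  using sum_le_suminf[OF assms(1), of "{0}"] assms(2,3) by (simp add: egf_def)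

text \<open>
  The bound on the ratio of consecutive coefficients makes all the series converge. It also
  makes the case \<open>a 0 = 0\<close> trivial, where the whole sequence vanishes; otherwise the
  generating function is positive and \<open>(ln g)'' = (g g'' - g'\<^sup>2) / g\<^sup>2\<close>.
\<close>
lemma log_convex_egf:
  fixes a :: "nat \<Rightarrow> real"
  assumes b: "b \<ge> 0" and nonneg: "\<And>n. 0 \<le> a n" and ratio: "\<And>n. a (Suc n) \<le> b * a n"
    and lc: "\<And>n. (a (Suc n))\<^sup>2 \<le> a n * a (Suc (Suc n))"
  shows "convex_on {0<..} (\<lambda>s. ln (egf a s))"
proof (cases "a 0 = 0")
  case True
  have "a n = 0" for n
    using le_geometric_of_ratio_le[of b a n, OF b ratio] nonneg[of n] True by simp
  then have "egf a s = 0" for s by (simp add: egf_def)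
  then show ?thesis by (simp add: convex_on_const)
next
  case False
  let ?g = "egf a" and ?g1 = "egf (\<lambda>n. a (Suc n))" and ?g2 = "egf (\<lambda>n. a (Suc (Suc n)))"
  have summ: "summable (\<lambda>n. a n / fact n * s ^ n)"
    "summable (\<lambda>n. a (Suc n) / fact n * s ^ n)"
    "summable (\<lambda>n. a (Suc (Suc n)) / fact n * s ^ n)" for s
    by (rule summable_egf[OF b]; simp add: nonneg ratio)+
  note D = has_real_derivative_egf[OF summ(1)] has_real_derivative_egf[OF summ(2)]
  have pos: "?g s > 0" if "s > 0" for s
    using egf_ge_constant_term[OF summ(1) nonneg, of s] nonneg[of 0] False that by linarith
  have disc: "(?g1 s)\<^sup>2 \<le> ?g s * ?g2 s" if s: "s > 0" for s
  proof -
    have "0 \<le> ?g s + 2 * t * ?g1 s + t\<^sup>2 * ?g2 s" for t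
    proof -
      have "(\<lambda>n. a n / fact n * s ^ n + 2 * t * (a (Suc n) / fact n * s ^ n)
              + t\<^sup>2 * (a (Suc (Suc n)) / fact n * s ^ n))
            sums (?g s + 2 * t * ?g1 s + t\<^sup>2 * ?g2 s)"
        unfolding egf_def by (intro sums_add sums_mult summable_sums summ)
      moreover have "0 \<le> a n / fact n * s ^ n + 2 * t * (a (Suc n) / fact n * s ^ n)
              + t\<^sup>2 * (a (Suc (Suc n)) / fact n * s ^ n)" for n
      proof -
        have "0 \<le> a n + 2 * t * a (Suc n) + t\<^sup>2 * a (Suc (Suc n))"
          using lc[of n] discriminant_le_iff_quadratic_nonneg[OF nonneg nonneg] by blast
        then have "0 \<le> (a n + 2 * t * a (Suc n) + t\<^sup>2 * a (Suc (Suc n))) * (s ^ n / fact n)"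
          using s by (intro mult_nonneg_nonneg) simp_all
        then show ?thesis by (simp add: field_simps)
      qed
      ultimately show ?thesis
        by (rule sums_le[OF _ sums_zero, rotated])
    qed
    moreover have "0 \<le> ?g2 s"
      using egf_ge_constant_term[OF summ(3) nonneg, of s] nonneg[of "Suc (Suc 0)"] s by linarith
    ultimately show ?thesis
      using discriminant_le_iff_quadratic_nonneg[OF less_imp_le[OF pos[OF s]]] by blast
  qed
  show ?thesis
  proof (rule f''_ge0_imp_convex)
    show "convex {0::real<..}" by simp
  next
    fix s :: real assume "s \<in> {0<..}"
    then have s: "s > 0" by simp
    note [derivative_intros] = D[THEN DERIV_chain2]
    show "((\<lambda>s. ln (?g s)) has_real_derivative ?g1 s / ?g s) (at s)"
      using pos[OF s] by (auto intro!: derivative_eq_intros)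
    show "((\<lambda>s. ?g1 s / ?g s) has_real_derivative
        (?g2 s * ?g s - ?g1 s * ?g1 s) / (?g s * ?g s)) (at s)"
      using pos[OF s] by (auto intro!: derivative_eq_intros)
    show "0 \<le> (?g2 s * ?g s - ?g1 s * ?g1 s) / (?g s * ?g s)"
      using disc[OF s] pos[OF s] by (simp add: power2_eq_square ac_simps)
  qed
qed

section \<open>Moments of a bounded nonnegative random variable\<close>

context prob_space
begin

abbreviation moment :: "('a \<Rightarrow> real) \<Rightarrow> nat \<Rightarrow> real" where
  "moment X n \<equiv> expectation (\<lambda>\<omega>. X \<omega> ^ n)"

text \<open>
  Truncated subtraction makes this \<open>moment X n\<close> for \<open>n \<le> p\<close> and \<open>moment X p * b ^ (n - p)\<close>
  from \<open>p\<close> on.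
\<close>
definition extended_moment :: "('a \<Rightarrow> real) \<Rightarrow> real \<Rightarrow> nat \<Rightarrow> nat \<Rightarrow> real" where
  "extended_moment X b p n = moment X (min n p) * b ^ (n - p)"

context
  fixes X :: "'a \<Rightarrow> real" and b :: real
  assumes X[measurable]: "X \<in> borel_measurable M"
    and range: "AE \<omega> in M. X \<omega> \<in> {0..b}"
begin

lemma integrable_moment: "integrable M (\<lambda>\<omega>. X \<omega> ^ n)"
proof (rule integrable_const_bound)
  show "AE \<omega> in M. norm (X \<omega> ^ n) \<le> b ^ n"
    using range by eventually_elim (auto simp: power_abs intro!: power_mono)
qed simp

lemma moment_nonneg: "0 \<le> moment X n"
  using range by (intro integral_nonneg_AE) auto

lemma moment_Suc_le: "moment X (Suc n) \<le> b * moment X n"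
proof -
  have "moment X (Suc n) \<le> expectation (\<lambda>\<omega>. b * X \<omega> ^ n)"
  proof (intro integral_mono_AE integrable_mult_right integrable_moment)
    show "AE \<omega> in M. X \<omega> ^ Suc n \<le> b * X \<omega> ^ n"
      using range by eventually_elim (auto intro!: mult_right_mono)
  qed
  then show ?thesis by simp
qed

text \<open>
  Cauchy--Schwarz, from \<open>X ^ n * (1 + t X)\<^sup>2 \<ge> 0\<close> for every \<open>t\<close>.
\<close>
lemma log_convex_moments: "(moment X (Suc n))\<^sup>2 \<le> moment X n * moment X (Suc (Suc n))"
proof -
  have "0 \<le> moment X n + 2 * t * moment X (Suc n) + t\<^sup>2 * moment X (Suc (Suc n))" for t
  proof -
    have "0 \<le> expectation (\<lambda>\<omega>. X \<omega> ^ n + 2 * t * X \<omega> ^ Suc n + t\<^sup>2 * X \<omega> ^ Suc (Suc n))"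
    proof (rule integral_nonneg_AE)
      show "AE \<omega> in M. 0 \<le> X \<omega> ^ n + 2 * t * X \<omega> ^ Suc n + t\<^sup>2 * X \<omega> ^ Suc (Suc n)"
        using range
      proof eventually_elim
        case (elim \<omega>)
        then have "0 \<le> X \<omega> ^ n * (1 + t * X \<omega>)\<^sup>2" by simp
        then show ?case by (simp add: power2_eq_square algebra_simps)
      qed
    qed
    also have "\<dots> = moment X n + 2 * t * moment X (Suc n) + t\<^sup>2 * moment X (Suc (Suc n))"
      using integrable_moment[of n] integrable_moment[of "Suc n"]
        integrable_moment[of "Suc (Suc n)"]
      by (simp del: power_Suc)
    finally show ?thesis .
  qed
  then show ?thesis
    using discriminant_le_iff_quadratic_nonneg[OF moment_nonneg moment_nonneg] by blast
qed

lemma bound_nonneg: "0 \<le> b"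
proof -
  have "AE \<omega> in M. 0 \<le> b" using range by eventually_elim auto
  then show ?thesis by simp
qed

lemma extended_moment_nonneg: "0 \<le> extended_moment X b p n"
  by (simp add: extended_moment_def moment_nonneg bound_nonneg)

lemma extended_moment_Suc_le: "extended_moment X b p (Suc n) \<le> b * extended_moment X b p n"
proof (cases "n < p")
  case True
  then show ?thesis using moment_Suc_le[of n] by (simp add: extended_moment_def min_def)
next
  case False
  then show ?thesis by (simp add: extended_moment_def min_def Suc_diff_le)
qed

lemma log_convex_extended_moments:
  "(extended_moment X b p (Suc n))\<^sup>2 \<le> extended_moment X b p n * extended_moment X b p (Suc (Suc n))"
proof -
  consider "Suc (Suc n) \<le> p" | "p = Suc n" | "p \<le> n" by linarith
  then show ?thesis
  proof cases
    case 1
    then show ?thesis using log_convex_moments[of n] by (simp add: extended_moment_def min_def)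
  next
    case 2
    have "moment X p * moment X p \<le> (b * moment X n) * moment X p"
      using moment_Suc_le[of n] moment_nonneg[of p] unfolding 2 by (rule mult_right_mono)
    then show ?thesis
      using 2 by (simp add: extended_moment_def min_def power2_eq_square ac_simps)
  next
    case 3
    then show ?thesis
      by (simp add: extended_moment_def min_def Suc_diff_le power2_eq_square)
  qed
qed

text \<open>
  The first \<open>p\<close> coefficients of \<open>T (p + 1) (s * b)\<close> are zero, and there the polynomial part
  supplies the moments; all later ones come from the exponential.
\<close>
lemma mgf_bound_eq_egf:
  assumes "b > 0"
  shows "mgf_bound M X b p = egf (extended_moment X b p)"
proof
  fix s
  let ?e = "\<lambda>n. moment X p / b ^ p * ((s * b) ^ n / fact n)"
  let ?m = "\<lambda>n. moment X n * s ^ n / fact n"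
  have "(\<lambda>n. ?e n + (if n \<in> {..<p} then ?m n - ?e n else 0))
      sums (moment X p / b ^ p * exp (s * b) + (\<Sum>n<p. ?m n - ?e n))"
    using exp_converges[of "s * b"]
    by (intro sums_add sums_mult sums_If_finite_set) (simp_all add: divide_inverse_commute)
  moreover have "?e n + (if n \<in> {..<p} then ?m n - ?e n else 0)
      = extended_moment X b p n / fact n * s ^ n" for n
    using assms by (cases "n < p")
      (simp_all add: extended_moment_def min_def power_mult_distrib power_diff)
  moreover have "moment X p / b ^ p * exp (s * b) + (\<Sum>n<p. ?m n - ?e n) = mgf_bound M X b p s"
  proof -
    have "expectation (\<lambda>\<omega>. \<Sum>j<p. s ^ j * X \<omega> ^ j / fact j) = (\<Sum>n<p. ?m n)"
      by (subst Bochner_Integration.integral_sum)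
        (simp_all add: integrable_moment mult.commute)
    then show ?thesis
      by (simp add: mgf_bound_def T_def sum_subtractf sum_distrib_left right_diff_distrib)
  qed
  ultimately show "mgf_bound M X b p s = egf (extended_moment X b p) s"
    by (simp add: egf_def sums_iff)
qed

lemma first_moment_pos:
  assumes "\<not> (AE \<omega> in M. X \<omega> = 0)"
  shows "0 < moment X 1"
proof -
  have "AE \<omega> in M. 0 \<le> X \<omega>" using range by eventually_elim auto
  with assms integrable_moment[of 1] have "moment X 1 \<noteq> 0"
    by (simp add: integral_nonneg_eq_0_iff_AE)
  then show ?thesis using moment_nonneg[of 1] by simp
qed

end

end

section \<open>Log-convexity of the derivative of the bound\<close>

theorem lemma1:
  fixes M :: "'a measure" and X :: "'a \<Rightarrow> real" and b :: real and p :: nat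
    and z :: "real \<Rightarrow> real"
  assumes "prob_space M"
    and "X \<in> borel_measurable M"
    and "b > 0"
    and "measure M {\<omega> \<in> space M. X \<omega> \<in> {0..b}} = 1"
    and "p \<ge> 1"
    and "z = mgf_bound M X b p"
  shows "(\<forall>s>0. z differentiable (at s))
    \<and> (\<not> (AE \<omega> in M. X \<omega> = 0) \<longrightarrow> (\<forall>s>0. deriv z s > 0))
    \<and> convex_on {0<..} (\<lambda>s. ln (deriv z s))"
proof -
  interpret prob_space M by fact
  note [measurable] = \<open>X \<in> borel_measurable M\<close>
  have "{\<omega> \<in> space M. X \<omega> \<in> {0..b}} \<in> sets M" by measurable
  then have range: "AE \<omega> in M. X \<omega> \<in> {0..b}"
    using assms(4) by (simp only: prob_Collect_eq_1)
  note X = assms(2) range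
  let ?c = "extended_moment X b p"
  note nonneg = extended_moment_nonneg[OF X] and ratio = extended_moment_Suc_le[OF X]
    and b = less_imp_le[OF \<open>b > 0\<close>]
  have z: "z = egf ?c"
    using mgf_bound_eq_egf[OF X] assms by simp
  have D: "(z has_real_derivative egf (\<lambda>n. ?c (Suc n)) s) (at s)" for s
    unfolding z by (intro has_real_derivative_egf summable_egf[OF b] nonneg ratio)
  then have deriv: "deriv z = egf (\<lambda>n. ?c (Suc n))"
    using DERIV_imp_deriv by blast
  have "z differentiable (at s)" for s
    using D real_differentiable_def by blast
  moreover have "deriv z s > 0" if "\<not> (AE \<omega> in M. X \<omega> = 0)" "s > 0" for s
  proof -
    (* p \<ge> 1 is what makes the constant term of z' the first moment. *)
    have "?c (Suc 0) = moment X 1"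
      using \<open>p \<ge> 1\<close> by (simp add: extended_moment_def min_def)
    moreover have "?c (Suc 0) \<le> deriv z s"
      unfolding deriv using that(2)
      by (intro egf_ge_constant_term summable_egf[OF b] nonneg ratio) simp
    ultimately show ?thesis using first_moment_pos[OF X that(1)] by linarith
  qed
  moreover have "convex_on {0<..} (\<lambda>s. ln (deriv z s))"
    unfolding deriv
    by (intro log_convex_egf[OF b] nonneg ratio log_convex_extended_moments[OF X])
  ultimately show ?thesis by blast
qed

end
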